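(* The following assertions hold. (i) For all $a\in(0,1]$, $b\in(0,\infty)$ and $c\in\left[\frac1a,\infty\right)$, $$\sum_{n=1}^\infty \frac{1}{c^n}\int_0^\infty e^{ax-\frac{b}{x}}\,x^{n-\frac32}\,\Gamma(1-n,x)\,dx = 2\sqrt{\pi}\int_{\sqrt{1-a}}^\infty \frac{e^{-2\sqrt{b}\,u}}{cu^2+ac-1}\,du = \sqrt{\frac{\pi}{b}}\;\mathbb{E}\left((c\xi^2+ac-1)^{-1}\mathbf{1}_{\{\xi\geq\sqrt{1-a}\}}\right),$$ where $\xi$ is an exponentially distributed random variable with parameter $2\sqrt{b}$. (ii) For every $b\in(0,\infty)$, the series $$\sum_{n=1}^\infty \frac{1}{c^n}\int_0^\infty e^{ax-\frac{b}{x}}\,x^{n-\frac32}\,\Gamma(1-n,x)\,dx$$ is convergent if $a\in(0,1)$ and $c\in\left[\frac1a,\infty\right)$, and also if $a=1$ and $c\in(1,\infty)$; it is divergent if $a=1$ and $c=1$. (iii) For all $b\in(0,\infty)$ and $c\in(1,\infty)$, $$\sum_{n=1}^\infty \frac{1}{c^n}\int_0^\infty e^{x-\frac{b}{x}}\,x^{n-\frac32}\,\Gamma(1-n,x)\,dx = 2\sqrt{\pi}\int_0^\infty\frac{e^{-2\sqrt{b}\,u}}{cu^2+c-1}\,du = \sqrt{\frac{\pi}{c(c-1)}}\Big[2\sin(\ell_{b,c})\,\mathrm{Ci}(\ell_{b,c})+\cos(\ell_{b,c})\big(\pi-2\,\mathrm{Si}(\ell_{b,c})\big)\Big],$$ where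 $\ell_{b,c}:=2\sqrt{\frac{b(c-1)}{c}}$.
   Context: For $p\in\mathbb{R}$ and $x>0$, $\Gamma(p,x):=\int_x^\infty u^{p-1}e^{-u}\,du$ is the upper incomplete Gamma function. The sine and cosine integrals are $\mathrm{Si}(z):=\int_0^z\frac{\sin t}{t}\,dt$ and $\mathrm{Ci}(z):=-\int_z^\infty\frac{\cos t}{t}\,dt$ for $z>0$ (the latter as a convergent improper integral). An exponentially distributed random variable with parameter $\theta>0$ has density $\theta e^{-\theta u}$ for $u>0$ and $0$ otherwise. $\mathbf{1}_A$ denotes the indicator of the event $A$ and $\mathbb{E}$ denotes expectation. All the terms of the series, and the integrands (almost everywhere), in (i) are nonnegative; the equalities in (i) are understood in $[0,\infty]$, the value $+\infty$ being allowed (a series of nonnegative terms with sum $+\infty$ is divergent). *)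

theory Defs
  imports "HOL-Probability.Probability"
begin

definition upper_Gamma :: "real \<Rightarrow> real \<Rightarrow> real" where
  "upper_Gamma p x = (LBINT u:{x<..}. u powr (p - 1) * exp (- u))"

(* Only conditionally convergent, hence a limit of integrals over bounded intervals;
   the sine integral Si is the one of HOL-Probability. *)
definition Ci :: "real \<Rightarrow> real" where
  "Ci z = - Lim at_top (\<lambda>T::real. LBINT t=z..T. cos t / t)"

definition series_integrand :: "real \<Rightarrow> real \<Rightarrow> nat \<Rightarrow> real \<Rightarrow> real" where
  "series_integrand a b n x =
     exp (a * x - b / x) * x powr (real n - 3 / 2) * upper_Gamma (1 - real n) x"

(* The n-th term, once with the integral of a nonnegative function taken in [0,\<infinity>] and once
   as a real number; the latter is meaningful only if the integrand is integrable, as the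
   Bochner integral of a non-integrable function is 0. *)
definition series_term_ennreal :: "real \<Rightarrow> real \<Rightarrow> real \<Rightarrow> nat \<Rightarrow> ennreal" where
  "series_term_ennreal a b c n =
     ennreal (1 / c ^ n) * (\<integral>\<^sup>+ x\<in>{0<..}. ennreal (series_integrand a b n x) \<partial>lborel)"

definition series_term :: "real \<Rightarrow> real \<Rightarrow> real \<Rightarrow> nat \<Rightarrow> real" where
  "series_term a b c n = 1 / c ^ n * (LBINT x:{0<..}. series_integrand a b n x)"

definition terms_well_defined :: "real \<Rightarrow> real \<Rightarrow> bool" where
  "terms_well_defined a b \<longleftrightarrow> (\<forall>n\<ge>1. set_integrable lborel {0<..} (series_integrand a b n))"

definition ell :: "real \<Rightarrow> real \<Rightarrow> real" where
  "ell b c = 2 * sqrt (b * (c - 1) / c)"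

end

theory Submission
  imports Defs
begin

text \<open>
The substitution \<open>u = x * (a + w\<^sup>2)\<close> in the incomplete Gamma function removes the factor
\<open>exp (a * x)\<close> and almost all powers of \<open>x\<close>: the integrand of the \<open>n\<close>-th term becomes
the integral over \<open>w > sqrt (1 - a)\<close> of
\<open>2 * w / (a + w\<^sup>2) ^ n * (exp (- (w\<^sup>2 * x) - b / x) / sqrt x)\<close>
(\<open>series_integrand_eq_nn_integral\<close>). The integral over \<open>x\<close> of the last factor does not
involve \<open>n\<close> and has the closed form \<open>sqrt pi / w * exp (- 2 * sqrt b * w)\<close>
(\<open>nn_integral_exp_over_sqrt\<close>). Hence, by Tonelli, the \<open>n\<close>-th term is
\<open>2 * sqrt pi\<close> times the integral of
\<open>exp (- 2 * sqrt b * w) / (c * (a + w\<^sup>2)) ^ n\<close>. Summing the geometric series under the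
integral gives the first identity of (i) (\<open>suminf_series_term_ennreal\<close>), and the expectation
is this integral written with the exponential density.

Since all terms are nonnegative, the series converges if and only if the resulting integral is finite.
For \<open>c > 1\<close>, which holds automatically when \<open>a < 1\<close>, the denominator
\<open>c * w\<^sup>2 + a * c - 1\<close> is bounded below by \<open>c - 1\<close>, whereas for
\<open>a = c = 1\<close> the integrand has a non-integrable singularity of type \<open>1 / w\<^sup>2\<close> at
\<open>0\<close>. This is (ii).

For (iii) it remains to evaluate the Laplace transform of \<open>1 / (1 + u\<^sup>2)\<close>. Writing
\<open>1 / t\<close> as an integral of exponentials and exchanging integrals represents both
\<open>pi / 2 - Si z\<close> and \<open>- Ci z\<close> as integrals of
\<open>exp (- (u * z)) / (1 + u\<^sup>2)\<close> times a combination of \<open>sin z\<close> and \<open>cos z\<close>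
that is linear in \<open>u\<close>; a rotation by the angle \<open>z\<close> isolates the Laplace transform
(\<open>laplace_inverse_1_plus_square\<close>).
\<close>

section \<open>A Gaussian integral\<close>

text \<open>
This \<open>E\<close> is the error function up to the factor \<open>sqrt pi / 2\<close>; only its derivative and
its limits matter.
\<close>

lemma gaussian_antiderivative:
  obtains E :: "real \<Rightarrow> real"
  where "\<And>w. (E has_real_derivative exp (- w\<^sup>2)) (at w)"
    and "(E \<longlongrightarrow> sqrt pi / 2) at_top" and "(E \<longlongrightarrow> - (sqrt pi / 2)) at_bot"
proof
  define E :: "real \<Rightarrow> real" where "E w = (LBINT t=ereal 0..ereal w. exp (- t\<^sup>2))" for w
  show "(E has_real_derivative exp (- w\<^sup>2)) (at w)" for w
  proof -
    have "(at w within {min 0 (w - 1)..max 0 (w + 1)}) = at w"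
      by (intro at_within_interior) auto
    moreover have "min 0 (w - 1) \<le> w" "w \<le> max 0 (w + 1)"
      by auto
    moreover have "continuous_on {min 0 (w - 1)..max 0 (w + 1)} (\<lambda>t. exp (- t\<^sup>2))"
      by (intro continuous_intros)
    ultimately show ?thesis
      using interval_integral_FTC2[of "min 0 (w - 1)" 0 "max 0 (w + 1)" "\<lambda>t. exp (- t\<^sup>2)" w]
      by (auto simp: E_def[abs_def] has_real_derivative_iff_has_vector_derivative
               split del: if_split)
  qed
  let ?g = "\<lambda>x::real. indicator {0..} x *\<^sub>R exp (- x\<^sup>2)"
  have lim_int: "((\<lambda>y. \<integral>x. indicator {..y} x *\<^sub>R ?g x \<partial>lborel) \<longlongrightarrow> (\<integral>x. ?g x \<partial>lborel)) at_top"
    using gaussian_moment_0 by (intro tendsto_integral_at_top) (auto simp: has_bochner_integral_iff)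
  have total: "(\<integral>x. ?g x \<partial>lborel) = sqrt pi / 2"
    using gaussian_moment_0 by (rule has_bochner_integral_integral_eq)
  have ev: "\<forall>\<^sub>F y in at_top. (\<integral>x. indicator {..y} x *\<^sub>R ?g x \<partial>lborel) = E y"
    using eventually_ge_at_top[of 0]
  proof eventually_elim
    case (elim y)
    then show ?case
      by (auto simp: E_def interval_integral_Icc set_lebesgue_integral_def
               intro!: Bochner_Integration.integral_cong split: split_indicator)
  qed
  show lim: "(E \<longlongrightarrow> sqrt pi / 2) at_top"
    by (rule Lim_transform_eventually[OF lim_int[unfolded total] ev])
  \<comment> \<open>\<open>E\<close> is odd, so the limit at \<open>-\<infinity>\<close> is the one at \<open>\<infinity>\<close> negated.\<close>
  have odd: "E (- w) = - E w" for w
  proof -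
    have "E (- w) = (LBINT t=ereal w..ereal 0. exp (- t\<^sup>2))"
      unfolding E_def by (subst interval_integral_reflect) simp
    also have "\<dots> = - E w"
      unfolding E_def by (rule interval_integral_endpoints_reverse)
    finally show ?thesis .
  qed
  have "((\<lambda>w. E (- w)) \<longlongrightarrow> - (sqrt pi / 2)) at_top"
    unfolding odd by (intro tendsto_minus lim)
  then show "(E \<longlongrightarrow> - (sqrt pi / 2)) at_bot"
    by (simp add: filterlim_at_bot_mirror)
qed

text \<open>
With \<open>k = w * sqrt b\<close>, both
\<open>exp (2 * k) * exp (- (w * sqrt x + sqrt b / sqrt x)\<^sup>2)\<close> and
\<open>exp (- 2 * k) * exp (- (w * sqrt x - sqrt b / sqrt x)\<^sup>2)\<close> equal
\<open>exp (- (w\<^sup>2 * x) - b / x)\<close>, and the inner derivatives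
\<open>(w \<mp> sqrt b / x) / (2 * sqrt x)\<close> add up to \<open>w / sqrt x\<close>. Hence the integrand has the
elementary antiderivative \<open>F\<close> below in terms of \<open>E\<close>. As \<open>x\<close> goes from \<open>0\<close> to infinity
the argument of the first \<open>E\<close> tends to \<open>\<infinity>\<close> at both ends, so its contribution
cancels, while that of the second one runs from \<open>-\<infinity>\<close> to \<open>\<infinity>\<close>.
\<close>

lemma nn_integral_exp_over_sqrt:
  fixes b w :: real
  assumes b: "0 < b" and w: "0 < w"
  shows "(\<integral>\<^sup>+x\<in>{0<..}. ennreal (exp (- (w\<^sup>2 * x) - b / x) / sqrt x) \<partial>lborel)
           = ennreal (sqrt pi / w * exp (- 2 * sqrt b * w))"
proof -
  obtain E :: "real \<Rightarrow> real" where E: "\<And>w. (E has_real_derivative exp (- w\<^sup>2)) (at w)"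
    and E_top: "(E \<longlongrightarrow> sqrt pi / 2) at_top" and E_bot: "(E \<longlongrightarrow> - (sqrt pi / 2)) at_bot"
    using gaussian_antiderivative by blast
  define f where "f x = exp (- (w\<^sup>2 * x) - b / x) / sqrt x" for x
  define k where "k = sqrt b * w"
  define F where "F x = (exp (2 * k) * E (w * sqrt x + sqrt b / sqrt x)
      + exp (- 2 * k) * E (w * sqrt x - sqrt b / sqrt x)) / w" for x
  have deriv: "(F has_real_derivative f x) (at x)" if "x > 0" for x
  proof -
    have sx: "sqrt x > 0" "sqrt x * sqrt x = x" "sqrt b * sqrt b = b"
      using that b by auto
    have P: "exp (2 * k) * exp (- (w * sqrt x + sqrt b / sqrt x)\<^sup>2) = exp (- (w\<^sup>2 * x) - b / x)"
      unfolding exp_add[symmetric] using sx that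
      by (simp add: k_def power2_eq_square field_simps)
    have M: "exp (- 2 * k) * exp (- (w * sqrt x - sqrt b / sqrt x)\<^sup>2) = exp (- (w\<^sup>2 * x) - b / x)"
      unfolding exp_add[symmetric] using sx that
      by (simp add: k_def power2_eq_square field_simps)
    have dp: "((\<lambda>x. w * sqrt x + sqrt b / sqrt x) has_real_derivative
        (w - sqrt b / x) / (2 * sqrt x)) (at x)"
      using that sx by (auto intro!: derivative_eq_intros simp: field_simps)
    have dm: "((\<lambda>x. w * sqrt x - sqrt b / sqrt x) has_real_derivative
        (w + sqrt b / x) / (2 * sqrt x)) (at x)"
      using that sx by (auto intro!: derivative_eq_intros simp: field_simps)
    have "(F has_real_derivative
       (exp (2 * k) * (exp (- (w * sqrt x + sqrt b / sqrt x)\<^sup>2) * ((w - sqrt b / x) / (2 * sqrt x)))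
      + exp (- 2 * k) * (exp (- (w * sqrt x - sqrt b / sqrt x)\<^sup>2) * ((w + sqrt b / x) / (2 * sqrt x)))) / w) (at x)"
      unfolding F_def
      by (intro DERIV_cdivide DERIV_add DERIV_cmult DERIV_chain2[OF E] dp dm)
    also have "(exp (2 * k) * (exp (- (w * sqrt x + sqrt b / sqrt x)\<^sup>2) * ((w - sqrt b / x) / (2 * sqrt x)))
      + exp (- 2 * k) * (exp (- (w * sqrt x - sqrt b / sqrt x)\<^sup>2) * ((w + sqrt b / x) / (2 * sqrt x)))) / w
      = f x"
      unfolding mult.assoc[symmetric] P M f_def using w sx by (simp add: field_simps)
    finally show ?thesis .
  qed
  have top: "filterlim (\<lambda>x. w * sqrt x) at_top at_top"
    by (intro filterlim_tendsto_pos_mult_at_top[OF tendsto_const w] sqrt_at_top)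
  have zero: "((\<lambda>x. sqrt b / sqrt x) \<longlongrightarrow> 0) at_top"
    by (intro tendsto_divide_0[OF tendsto_const] filterlim_at_top_imp_at_infinity sqrt_at_top)
  have B: "(F \<longlongrightarrow> (exp (2 * k) * (sqrt pi / 2) + exp (- 2 * k) * (sqrt pi / 2)) / w) at_top"
    unfolding F_def
  proof (intro tendsto_divide tendsto_add tendsto_mult tendsto_const filterlim_compose[OF E_top])
    show "filterlim (\<lambda>x. w * sqrt x + sqrt b / sqrt x) at_top at_top"
      using filterlim_tendsto_add_at_top[OF zero top] by (simp add: add.commute)
    show "filterlim (\<lambda>x. w * sqrt x - sqrt b / sqrt x) at_top at_top"
      using filterlim_tendsto_add_at_top[OF tendsto_minus[OF zero] top] by simp
  qed (use w in auto)
  have zero': "((\<lambda>x. w * sqrt x) \<longlongrightarrow> 0) (at_right 0)"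
    by (auto intro!: tendsto_eq_intros)
  have "filterlim sqrt (at_right 0) (at_right 0)"
    unfolding filterlim_at
    by (auto intro!: tendsto_eq_intros simp: eventually_at_filter)
  then have top': "filterlim (\<lambda>x. sqrt b / sqrt x) at_top (at_right 0)"
    unfolding divide_inverse using b
    by (intro filterlim_tendsto_pos_mult_at_top[OF tendsto_const]
              filterlim_compose[OF filterlim_inverse_at_top_right]) auto
  have A: "(F \<longlongrightarrow> (exp (2 * k) * (sqrt pi / 2) + exp (- 2 * k) * (- (sqrt pi / 2))) / w) (at_right 0)"
    unfolding F_def
  proof (intro tendsto_divide tendsto_add tendsto_mult tendsto_const
      filterlim_compose[OF E_top] filterlim_compose[OF E_bot])
    show "filterlim (\<lambda>x. w * sqrt x + sqrt b / sqrt x) at_top (at_right 0)"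
      by (rule filterlim_tendsto_add_at_top[OF zero' top'])
    have "filterlim (\<lambda>x. - (w * sqrt x) + sqrt b / sqrt x) at_top (at_right 0)"
      using filterlim_tendsto_add_at_top[OF tendsto_minus[OF zero'] top'] by simp
    then show "filterlim (\<lambda>x. w * sqrt x - sqrt b / sqrt x) at_bot (at_right 0)"
      by (simp add: filterlim_uminus_at_bot)
  qed (use w in auto)
  have cont: "isCont f x" if "x > 0" for x
    unfolding f_def using that by (auto intro!: continuous_intros)
  have f_nonneg: "f x \<ge> 0" if "x > 0" for x
    using that by (simp add: f_def)
  have at0: "((F \<circ> real_of_ereal) \<longlongrightarrow>
      (exp (2 * k) * (sqrt pi / 2) + exp (- 2 * k) * (- (sqrt pi / 2))) / w) (at_right (ereal 0))"
    using A by (simp add: ereal_tendsto_simps)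
  have atinf: "((F \<circ> real_of_ereal) \<longlongrightarrow>
      (exp (2 * k) * (sqrt pi / 2) + exp (- 2 * k) * (sqrt pi / 2)) / w) (at_left \<infinity>)"
    using B by (simp add: ereal_tendsto_simps)
  have "set_integrable lborel (einterval (ereal 0) \<infinity>) f"
    by (rule interval_integral_FTC_nonneg[OF _ _ _ _ at0 atinf]) (auto intro!: deriv cont f_nonneg)
  moreover have alg: "(p * (q / 2) + m * (q / 2)) / w - (p * (q / 2) + m * (- (q / 2))) / w = q / w * m"
    for p q m :: real
    using w by (simp add: field_simps)
  have "(LBINT x=ereal 0..\<infinity>. f x) =
      (exp (2 * k) * (sqrt pi / 2) + exp (- 2 * k) * (sqrt pi / 2)) / w
      - (exp (2 * k) * (sqrt pi / 2) + exp (- 2 * k) * (- (sqrt pi / 2))) / w"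
    by (rule interval_integral_FTC_nonneg[OF _ _ _ _ at0 atinf]) (auto intro!: deriv cont f_nonneg)
  then have "(LBINT x=ereal 0..\<infinity>. f x) = sqrt pi / w * exp (- 2 * k)"
    using w by (simp only: alg)
  ultimately have "(\<integral>\<^sup>+x\<in>{0<..}. ennreal (f x) \<partial>lborel)
      = ennreal (sqrt pi / w * exp (- 2 * sqrt b * w))"
    unfolding nn_integral_set_ennreal
    by (subst nn_integral_eq_integral)
       (auto simp: set_integrable_def interval_integral_to_infinity_eq set_lebesgue_integral_def
          mult_ac k_def f_nonneg split: split_indicator)
  then show ?thesis
    by (simp add: f_def)
qed

section \<open>The terms of the series\<close>

text \<open>
The substitution is \<open>u = x * (a + w\<^sup>2)\<close>, which maps \<open>w = sqrt (1 - a)\<close> to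
\<open>u = x\<close>. The power is at most \<open>x powr (- n)\<close> on this range, so the transformed
integrand is dominated by a multiple of the derivative of
\<open>- exp (- (x * (a + w\<^sup>2)))\<close>.
\<close>

lemma upper_Gamma_integrand_integrable_quadratic_substitution:
  fixes a x :: real and n :: nat
  assumes a: "0 < a" "a \<le> 1" and x: "0 < x"
  defines "h \<equiv> \<lambda>w. (x * (a + w\<^sup>2)) powr (- real n) * exp (- (x * (a + w\<^sup>2))) * (2 * x * w)"
  shows "set_integrable lborel {sqrt (1 - a)<..} h"
    and "upper_Gamma (1 - real n) x = (LBINT w:{sqrt (1 - a)<..}. h w)"
proof -
  define r where "r = sqrt (1 - a)"
  have r: "r \<ge> 0" "r\<^sup>2 = 1 - a" using a by (auto simp: r_def)
  define q where "q w = x * (a + w\<^sup>2)" for w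
  have q_ge: "q w \<ge> x" if "w \<ge> r" for w
  proof -
    have "w\<^sup>2 \<ge> r\<^sup>2" using that r by (intro power_mono) auto
    then have "a + w\<^sup>2 \<ge> 1" using r by simp
    then show ?thesis using x by (simp add: q_def)
  qed
  have q_top: "filterlim q at_top at_top"
    unfolding q_def
    by (intro filterlim_tendsto_pos_mult_at_top[OF tendsto_const x]
          filterlim_tendsto_add_at_top[OF tendsto_const] filterlim_pow_at_top filterlim_ident) simp
  have dq: "(q has_real_derivative 2 * x * w) (at w)" for w
    unfolding q_def by (auto intro!: derivative_eq_intros)
  have exp_q: "((\<lambda>w. - (exp (- q w))) \<longlongrightarrow> - 0) at_top"
    by (intro tendsto_minus filterlim_compose[OF exp_at_bot])
       (simp add: filterlim_uminus_at_bot q_top)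
  have dom: "set_integrable lborel (einterval (ereal r) \<infinity>) (\<lambda>w. exp (- q w) * (2 * x * w))"
  proof (rule interval_integral_FTC_nonneg)
    show "((\<lambda>w. - exp (- q w)) has_real_derivative exp (- q w) * (2 * x * w)) (at w)" for w
      by (auto intro!: derivative_eq_intros dq)
    show "(((\<lambda>w. - exp (- q w)) \<circ> real_of_ereal) \<longlongrightarrow> - exp (- q r)) (at_right (ereal r))"
      unfolding ereal_tendsto_simps q_def by (intro tendsto_intros)
    show "(((\<lambda>w. - exp (- q w)) \<circ> real_of_ereal) \<longlongrightarrow> - 0) (at_left \<infinity>)"
      unfolding ereal_tendsto_simps by (rule exp_q)
  qed (use r x in \<open>auto simp: q_def intro!: continuous_intros\<close>)
  have h_eq: "h w = q w powr (- real n) * exp (- q w) * (2 * x * w)" for w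
    by (simp add: h_def q_def)
  have int: "set_integrable lborel (einterval (ereal r) \<infinity>) h"
    unfolding set_integrable_def
  proof (rule Bochner_Integration.integrable_bound)
    show "integrable lborel (\<lambda>w. x powr (- real n) *
        (indicator (einterval (ereal r) \<infinity>) w *\<^sub>R (exp (- q w) * (2 * x * w))))"
      using dom unfolding set_integrable_def by (intro integrable_mult_right)
    show "AE w in lborel. norm (indicator (einterval (ereal r) \<infinity>) w *\<^sub>R h w)
        \<le> norm (x powr (- real n) * (indicator (einterval (ereal r) \<infinity>) w *\<^sub>R (exp (- q w) * (2 * x * w))))"
    proof (rule AE_I2)
      fix w :: real
      have "\<bar>h w\<bar> \<le> \<bar>x powr (- real n) * (exp (- q w) * (2 * x * w))\<bar>" if "w > r"
        using that r x q_ge[of w]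
        by (auto simp: h_eq abs_mult mult.assoc intro!: mult_right_mono powr_mono2')
      then show "norm (indicator (einterval (ereal r) \<infinity>) w *\<^sub>R h w)
        \<le> norm (x powr (- real n) * (indicator (einterval (ereal r) \<infinity>) w *\<^sub>R (exp (- q w) * (2 * x * w))))"
        by (auto split: split_indicator)
    qed
  qed (simp add: h_def)
  then show "set_integrable lborel {sqrt (1 - a)<..} h"
    by (simp add: r_def)
  have "(LBINT u=ereal x..\<infinity>. u powr (- real n) * exp (- u)) = (LBINT w=ereal r..\<infinity>. h w)"
    unfolding h_eq
  proof (rule interval_integral_substitution_nonneg[where g = q])
    show "((ereal \<circ> q \<circ> real_of_ereal) \<longlongrightarrow> ereal x) (at_right (ereal r))"
    proof -
      have "(q \<longlongrightarrow> q r) (at_right r)"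
        unfolding q_def by (intro tendsto_intros)
      moreover have "q r = x" by (simp add: q_def r)
      ultimately show ?thesis
        by (simp add: ereal_tendsto_simps)
    qed
    show "((ereal \<circ> q \<circ> real_of_ereal) \<longlongrightarrow> \<infinity>) (at_left \<infinity>)"
      using q_top by (simp add: ereal_tendsto_simps)
    show "isCont (\<lambda>u. u powr (- real n) * exp (- u)) (q w)" if "ereal r < ereal w" for w
      using q_ge[of w] that x by (auto intro!: continuous_intros)
    show "set_integrable lborel (einterval (ereal r) \<infinity>)
        (\<lambda>w. q w powr (- real n) * exp (- q w) * (2 * x * w))"
      using int unfolding h_eq .
  qed (use r x dq in auto)
  then show "upper_Gamma (1 - real n) x = (LBINT w:{sqrt (1 - a)<..}. h w)"
    by (simp add: upper_Gamma_def interval_integral_to_infinity_eq r_def)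
qed

text \<open>
The substitution is chosen so that \<open>exp (a * x)\<close> cancels against the factor
\<open>exp (- (x * a))\<close> of the transformed integrand, and so that the powers of \<open>x\<close> collapse to
\<open>1 / sqrt x\<close> whatever \<open>n\<close> is.
\<close>

lemma series_integrand_eq_nn_integral:
  fixes a b x :: real and n :: nat
  assumes a: "0 < a" "a \<le> 1" and x: "0 < x"
  shows "series_integrand a b n x \<ge> 0"
    and "ennreal (series_integrand a b n x) =
      (\<integral>\<^sup>+w\<in>{sqrt (1 - a)<..}. ennreal (2 * w / (a + w\<^sup>2) ^ n * (exp (- (w\<^sup>2 * x) - b / x) / sqrt x)) \<partial>lborel)"
proof -
  define h where "h w = (x * (a + w\<^sup>2)) powr (- real n) * exp (- (x * (a + w\<^sup>2))) * (2 * x * w)" for w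
  have r: "sqrt (1 - a) \<ge> 0" using a by simp
  have int: "set_integrable lborel {sqrt (1 - a)<..} h"
    and val: "upper_Gamma (1 - real n) x = (LBINT w:{sqrt (1 - a)<..}. h w)"
    unfolding h_def
    by (rule upper_Gamma_integrand_integrable_quadratic_substitution[OF a x])+
  have h_nonneg: "h w \<ge> 0" if "w > sqrt (1 - a)" for w
    using le_less_trans[OF r that] x by (auto simp: h_def)
  have Gamma_nonneg: "upper_Gamma (1 - real n) x \<ge> 0"
    unfolding val set_lebesgue_integral_def
    by (intro Bochner_Integration.integral_nonneg) (auto simp: h_nonneg split: split_indicator)
  then show "series_integrand a b n x \<ge> 0"
    by (simp add: series_integrand_def)
  define C where "C = exp (a * x - b / x) * x powr (real n - 3 / 2)"
  have C: "C \<ge> 0" by (simp add: C_def)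
  have Ch: "C * h w = 2 * w / (a + w\<^sup>2) ^ n * (exp (- (w\<^sup>2 * x) - b / x) / sqrt x)"
    if "w > sqrt (1 - a)" for w
  proof -
    have pos: "a + w\<^sup>2 > 0" using a by (intro add_pos_nonneg) auto
    have "x powr (real n - 3 / 2) * x powr (- real n) * x = x powr ((real n - 3 / 2) + (- real n) + 1)"
      unfolding powr_add using x by simp
    also have "\<dots> = x powr (- (1 / 2))" by (simp add: field_simps)
    also have "\<dots> = 1 / sqrt x" using x by (simp only: powr_minus powr_half_sqrt inverse_eq_divide less_imp_le)
    finally have px: "x powr (real n - 3 / 2) * x powr (- real n) * x = 1 / sqrt x" .
    have "exp (a * x - b / x) * exp (- (x * (a + w\<^sup>2))) = exp (- (w\<^sup>2 * x) - b / x)"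
      unfolding exp_add[symmetric] by (simp add: algebra_simps)
    moreover have "(x * (a + w\<^sup>2)) powr (- real n) = x powr (- real n) * (1 / (a + w\<^sup>2) ^ n)"
      using x pos by (subst powr_mult) (simp_all add: powr_minus powr_realpow inverse_eq_divide)
    ultimately have "C * h w = (exp (a * x - b / x) * exp (- (x * (a + w\<^sup>2)))) *
        (x powr (real n - 3 / 2) * x powr (- real n) * x) * (2 * w / (a + w\<^sup>2) ^ n)"
      unfolding C_def h_def by simp
    then show ?thesis
      unfolding px \<open>exp (a * x - b / x) * exp (- (x * (a + w\<^sup>2))) = exp (- (w\<^sup>2 * x) - b / x)\<close>
      by (simp add: mult_ac)
  qed
  have "ennreal (series_integrand a b n x) = ennreal C * ennreal (LBINT w:{sqrt (1 - a)<..}. h w)"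
    unfolding val[symmetric] ennreal_mult'[OF C, symmetric]
    by (simp only: series_integrand_def C_def)
  also have "ennreal (LBINT w:{sqrt (1 - a)<..}. h w) = (\<integral>\<^sup>+w\<in>{sqrt (1 - a)<..}. ennreal (h w) \<partial>lborel)"
    using int unfolding nn_integral_set_ennreal set_integrable_def set_lebesgue_integral_def
    by (subst nn_integral_eq_integral)
       (auto simp: mult.commute h_nonneg split: split_indicator)
  also have "ennreal C * \<dots> = (\<integral>\<^sup>+w. ennreal C * (ennreal (h w) * indicator {sqrt (1 - a)<..} w) \<partial>lborel)"
    by (rule nn_integral_cmult[symmetric]) (simp add: h_def)
  also have "\<dots> = (\<integral>\<^sup>+w\<in>{sqrt (1 - a)<..}. ennreal (2 * w / (a + w\<^sup>2) ^ n * (exp (- (w\<^sup>2 * x) - b / x) / sqrt x)) \<partial>lborel)"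
  proof (intro nn_integral_cong)
    fix w :: real
    show "ennreal C * (ennreal (h w) * indicator {sqrt (1 - a)<..} w)
      = ennreal (2 * w / (a + w\<^sup>2) ^ n * (exp (- (w\<^sup>2 * x) - b / x) / sqrt x)) * indicator {sqrt (1 - a)<..} w"
    proof (cases "w > sqrt (1 - a)")
      case True
      show ?thesis
        unfolding Ch[OF True, symmetric] ennreal_mult'[OF C] by (simp only: mult.assoc)
    qed simp
  qed
  finally show "ennreal (series_integrand a b n x) = \<dots>" .
qed

text \<open>
By Tonelli the integral over \<open>x\<close> can be done first, and it is
\<open>sqrt pi / w * exp (- 2 * sqrt b * w)\<close>; its denominator \<open>w\<close> cancels the Jacobian
\<open>2 * w\<close> of the substitution.
\<close>

lemma nn_integral_series_integrand:
  fixes a b :: real and n :: nat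
  assumes a: "0 < a" "a \<le> 1" and b: "0 < b"
  shows "(\<integral>\<^sup>+x\<in>{0<..}. ennreal (series_integrand a b n x) \<partial>lborel) =
    (\<integral>\<^sup>+w\<in>{sqrt (1 - a)<..}. ennreal (2 * sqrt pi * exp (- 2 * sqrt b * w) / (a + w\<^sup>2) ^ n) \<partial>lborel)"
proof -
  let ?r = "sqrt (1 - a)"
  have r: "?r \<ge> 0" using a by simp
  have pos: "a + w\<^sup>2 > 0" for w :: real using a by (intro add_pos_nonneg) auto
  let ?k = "\<lambda>x w. exp (- (w\<^sup>2 * x) - b / x) / sqrt x"
  let ?g = "\<lambda>x w. ennreal (2 * w / (a + w\<^sup>2) ^ n * ?k x w) * indicator {?r<..} w * indicator {0<..} x"
  have "(\<integral>\<^sup>+x\<in>{0<..}. ennreal (series_integrand a b n x) \<partial>lborel)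
      = (\<integral>\<^sup>+x. (\<integral>\<^sup>+w. ?g x w \<partial>lborel) \<partial>lborel)"
    by (intro nn_integral_cong)
       (auto simp: series_integrand_eq_nn_integral(2)[OF a] split: split_indicator)
  also have "\<dots> = (\<integral>\<^sup>+w. (\<integral>\<^sup>+x. ?g x w \<partial>lborel) \<partial>lborel)"
    by (rule lborel_pair.Fubini'[symmetric]) measurable
  also have "\<dots> = (\<integral>\<^sup>+w\<in>{?r<..}. ennreal (2 * sqrt pi * exp (- 2 * sqrt b * w) / (a + w\<^sup>2) ^ n) \<partial>lborel)"
  proof (intro nn_integral_cong)
    fix w :: real
    show "(\<integral>\<^sup>+x. ?g x w \<partial>lborel)
        = ennreal (2 * sqrt pi * exp (- 2 * sqrt b * w) / (a + w\<^sup>2) ^ n) * indicator {?r<..} w"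
    proof (cases "w > ?r")
      case True
      then have w: "w > 0" using le_less_trans[OF r] by simp
      define K where "K = 2 * w / (a + w\<^sup>2) ^ n"
      have K: "K \<ge> 0" using w pos[of w] by (simp add: K_def)
      have "(\<integral>\<^sup>+x. ?g x w \<partial>lborel) = (\<integral>\<^sup>+x. ennreal K * (ennreal (?k x w) * indicator {0<..} x) \<partial>lborel)"
        using True unfolding K_def[symmetric] ennreal_mult'[OF K] by (simp add: mult.assoc)
      also have "\<dots> = ennreal K * (\<integral>\<^sup>+x\<in>{0<..}. ennreal (?k x w) \<partial>lborel)"
        by (rule nn_integral_cmult) measurable
      also have "\<dots> = ennreal (K * (sqrt pi / w * exp (- 2 * sqrt b * w)))"
        unfolding nn_integral_exp_over_sqrt[OF b w] ennreal_mult'[OF K] ..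
      also have "K * (sqrt pi / w * exp (- 2 * sqrt b * w)) = 2 * sqrt pi * exp (- 2 * sqrt b * w) / (a + w\<^sup>2) ^ n"
        using w by (simp add: K_def)
      finally show ?thesis using True by simp
    qed simp
  qed
  finally show ?thesis .
qed

section \<open>Summation, integrability and divergence\<close>

lemma nn_integral_atLeast_eq_greaterThan:
  fixes r :: real
  shows "(\<integral>\<^sup>+u\<in>{r..}. f u \<partial>lborel) = (\<integral>\<^sup>+u\<in>{r<..}. f u \<partial>lborel)"
  using AE_lborel_singleton[of r]
  by (intro nn_integral_cong_AE) (auto elim!: eventually_mono split: split_indicator)

text \<open>
After exchanging sum and integral the series is geometric with ratio
\<open>1 / (c * (a + w\<^sup>2))\<close>. This ratio is below \<open>1\<close> for every \<open>w > sqrt (1 - a)\<close>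
because \<open>a * c \<ge> 1\<close> and \<open>w > 0\<close>; at \<open>w = 0\<close> it can be \<open>1\<close>, which is why
the boundary point is split off.
\<close>

lemma suminf_series_term_ennreal:
  fixes a b c :: real
  assumes a: "0 < a" "a \<le> 1" and b: "0 < b" and c: "1 / a \<le> c"
  shows "(\<Sum>n. series_term_ennreal a b c (Suc n)) =
    ennreal (2 * sqrt pi) *
      (\<integral>\<^sup>+u\<in>{sqrt (1 - a)..}. ennreal (exp (- 2 * sqrt b * u) / (c * u\<^sup>2 + a * c - 1)) \<partial>lborel)"
proof -
  let ?r = "sqrt (1 - a)"
  have r: "?r \<ge> 0" using a by simp
  have c0: "c > 0" and ac: "a * c \<ge> 1"
    using a c less_le_trans[of 0 "1 / a" c] by (auto simp: field_simps)
  define e where "e w = 2 * sqrt pi * exp (- 2 * sqrt b * w)" for w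
  have e: "e w \<ge> 0" for w by (simp add: e_def)
  have "(\<Sum>n. series_term_ennreal a b c (Suc n)) =
     (\<Sum>n. \<integral>\<^sup>+w. ennreal (1 / c ^ Suc n) * (ennreal (e w / (a + w\<^sup>2) ^ Suc n) * indicator {?r<..} w) \<partial>lborel)"
    unfolding series_term_ennreal_def nn_integral_series_integrand[OF a b] e_def
    by (intro suminf_cong nn_integral_cmult[symmetric]) measurable
  also have "\<dots> = (\<integral>\<^sup>+w. (\<Sum>n. ennreal (1 / c ^ Suc n) * (ennreal (e w / (a + w\<^sup>2) ^ Suc n) * indicator {?r<..} w)) \<partial>lborel)"
    unfolding e_def by (rule nn_integral_suminf[symmetric]) measurable
  also have "\<dots> = (\<integral>\<^sup>+w. ennreal (2 * sqrt pi) *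
      (ennreal (exp (- 2 * sqrt b * w) / (c * w\<^sup>2 + a * c - 1)) * indicator {?r<..} w) \<partial>lborel)"
  proof (intro nn_integral_cong)
    fix w :: real
    show "(\<Sum>n. ennreal (1 / c ^ Suc n) * (ennreal (e w / (a + w\<^sup>2) ^ Suc n) * indicator {?r<..} w))
       = ennreal (2 * sqrt pi) *
      (ennreal (exp (- 2 * sqrt b * w) / (c * w\<^sup>2 + a * c - 1)) * indicator {?r<..} w)"
    proof (cases "w > ?r")
      case True
      define Q where "Q = c * (a + w\<^sup>2)"
      define q where "q = 1 / Q"
      have "c * w\<^sup>2 > 0" using le_less_trans[OF r True] c0 by simp
      then have Q: "Q > 1" "c * w\<^sup>2 + a * c - 1 = Q - 1"
        using ac by (simp_all add: Q_def distrib_left mult.commute[of a c])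
      then have q: "0 < q" "q < 1" by (auto simp: q_def)
      have "(\<lambda>n. e w * q * q ^ n) sums (e w * q * (1 / (1 - q)))"
        using q by (intro sums_mult geometric_sums) auto
      moreover have "e w * q * (1 / (1 - q)) = e w / (c * w\<^sup>2 + a * c - 1)"
        unfolding Q(2) q_def using Q(1) by (simp add: field_simps)
      ultimately have s: "(\<lambda>n. e w * q * q ^ n) sums (e w / (c * w\<^sup>2 + a * c - 1))"
        by simp
      have "(\<Sum>n. ennreal (1 / c ^ Suc n) * (ennreal (e w / (a + w\<^sup>2) ^ Suc n) * indicator {?r<..} w))
          = (\<Sum>n. ennreal (e w * q * q ^ n))"
      proof (intro suminf_cong)
        fix n
        have "(1 / c ^ Suc n) * (e w / (a + w\<^sup>2) ^ Suc n) = e w * q ^ Suc n"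
          by (simp add: q_def Q_def power_mult_distrib divide_inverse power_inverse)
        then show "ennreal (1 / c ^ Suc n) * (ennreal (e w / (a + w\<^sup>2) ^ Suc n) * indicator {?r<..} w)
            = ennreal (e w * q * q ^ n)"
          using True c0 by (simp add: ennreal_mult'[symmetric] mult_ac)
      qed
      also have "\<dots> = ennreal (e w / (c * w\<^sup>2 + a * c - 1))"
        using e q by (intro suminf_ennreal_eq s) auto
      also have "\<dots> = ennreal (2 * sqrt pi) * ennreal (exp (- 2 * sqrt b * w) / (c * w\<^sup>2 + a * c - 1))"
        by (simp add: e_def ennreal_mult'[symmetric])
      finally show ?thesis using True by simp
    qed simp
  qed
  also have "\<dots> = ennreal (2 * sqrt pi) *
      (\<integral>\<^sup>+u\<in>{?r..}. ennreal (exp (- 2 * sqrt b * u) / (c * u\<^sup>2 + a * c - 1)) \<partial>lborel)"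
    unfolding nn_integral_atLeast_eq_greaterThan by (rule nn_integral_cmult) measurable
  finally show ?thesis .
qed

text \<open>
The normalising factor \<open>2 * sqrt b\<close> of the density turns \<open>sqrt (pi / b)\<close> into
\<open>2 * sqrt pi\<close>, and \<open>r \<ge> 0\<close> keeps the integration inside its support.
\<close>

lemma exponential_expectation_eq_nn_integral:
  fixes b r :: real and f :: "real \<Rightarrow> real"
  assumes b: "0 < b" and r: "0 \<le> r" and [measurable]: "f \<in> borel_measurable borel"
    and \<xi>: "distributed M lborel \<xi> (\<lambda>u. ennreal (exponential_density (2 * sqrt b) u))"
  shows "ennreal (sqrt (pi / b)) * (\<integral>\<^sup>+\<omega>. ennreal (inverse (f (\<xi> \<omega>)) * indicator {\<omega>. \<xi> \<omega> \<ge> r} \<omega>) \<partial>M)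
    = ennreal (2 * sqrt pi) * (\<integral>\<^sup>+u\<in>{r..}. ennreal (exp (- 2 * sqrt b * u) / f u) \<partial>lborel)"
proof -
  let ?d = "exponential_density (2 * sqrt b)"
  have "(\<integral>\<^sup>+\<omega>. ennreal (inverse (f (\<xi> \<omega>)) * indicator {\<omega>. \<xi> \<omega> \<ge> r} \<omega>) \<partial>M)
      = (\<integral>\<^sup>+\<omega>. ennreal (inverse (f (\<xi> \<omega>)) * indicator {r..} (\<xi> \<omega>)) \<partial>M)"
    by (intro nn_integral_cong) (auto split: split_indicator)
  also have "\<dots> = (\<integral>\<^sup>+u. ennreal (?d u) * ennreal (inverse (f u) * indicator {r..} u) \<partial>lborel)"
    by (rule distributed_nn_integral[OF \<xi>, symmetric]) measurable
  also have "ennreal (sqrt (pi / b)) * \<dots>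
      = (\<integral>\<^sup>+u. ennreal (sqrt (pi / b)) * (ennreal (?d u) * ennreal (inverse (f u) * indicator {r..} u)) \<partial>lborel)"
    by (rule nn_integral_cmult[symmetric]) measurable
  also have "\<dots> = (\<integral>\<^sup>+u. ennreal (2 * sqrt pi) * (ennreal (exp (- 2 * sqrt b * u) / f u) * indicator {r..} u) \<partial>lborel)"
  proof (intro nn_integral_cong)
    fix u :: real
    show "ennreal (sqrt (pi / b)) * (ennreal (?d u) * ennreal (inverse (f u) * indicator {r..} u))
        = ennreal (2 * sqrt pi) * (ennreal (exp (- 2 * sqrt b * u) / f u) * indicator {r..} u)"
    proof (cases "u \<ge> r")
      case True
      then have "sqrt (pi / b) * (?d u * inverse (f u)) = 2 * sqrt pi * (exp (- 2 * sqrt b * u) / f u)"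
        using b r by (simp add: exponential_density_def real_sqrt_divide field_simps)
      then show ?thesis
        using True b r
        by (simp add: ennreal_mult'[symmetric] exponential_density_def)
    qed simp
  qed
  also have "\<dots> = ennreal (2 * sqrt pi) * (\<integral>\<^sup>+u\<in>{r..}. ennreal (exp (- 2 * sqrt b * u) / f u) \<partial>lborel)"
    by (rule nn_integral_cmult) measurable
  finally show ?thesis .
qed

lemma nn_integral_exp_greaterThan:
  fixes \<beta> :: real
  assumes "0 < \<beta>"
  shows "(\<integral>\<^sup>+u\<in>{0<..}. ennreal (exp (- (\<beta> * u))) \<partial>lborel) = ennreal (1 / \<beta>)"
proof -
  have "set_integrable lborel {0<..} (\<lambda>u. exp (- (u * \<beta>)))"
    "(LBINT u:{0<..}. exp (- (u * \<beta>))) = 1 / \<beta>"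
    using integrable_I0i_exp_mscale[OF assms] LBINT_I0i_exp_mscale[OF assms]
    by (auto simp: interval_lebesgue_integral_0_infty)
  then show ?thesis
    unfolding nn_integral_set_ennreal set_integrable_def set_lebesgue_integral_def
    by (subst nn_integral_eq_integral) (auto simp: mult.commute)
qed

text \<open>
On \<open>w > sqrt (1 - a)\<close> the base \<open>a + w\<^sup>2\<close> is at least \<open>1\<close>, so the
integral is at most that of \<open>2 * sqrt pi * exp (- 2 * sqrt b * w)\<close> over \<open>w > 0\<close>. Measurability in \<open>x\<close>
comes from the representation of the integrand as a parameter integral.
\<close>

lemma series_integrand_integrable:
  fixes a b :: real
  assumes a: "0 < a" "a \<le> 1" and b: "0 < b"
  shows "set_integrable lborel {0<..} (series_integrand a b n)"
    and "(\<integral>\<^sup>+x\<in>{0<..}. ennreal (series_integrand a b n x) \<partial>lborel) =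
      ennreal (LBINT x:{0<..}. series_integrand a b n x)"
    and "0 \<le> (LBINT x:{0<..}. series_integrand a b n x)"
proof -
  let ?r = "sqrt (1 - a)" and ?s = "\<lambda>x. indicator {0<..} x *\<^sub>R series_integrand a b n x"
  have r: "?r \<ge> 0" using a by simp
  define G where "G x = (\<integral>\<^sup>+w\<in>{?r<..}. ennreal (2 * w / (a + w\<^sup>2) ^ n * (exp (- (w\<^sup>2 * x) - b / x) / sqrt x)) \<partial>lborel)" for x
  have [measurable]: "G \<in> borel_measurable borel"
    unfolding G_def by measurable
  have G_eq: "G x = ennreal (series_integrand a b n x)" if "x > 0" for x
    unfolding G_def by (rule series_integrand_eq_nn_integral(2)[OF a that, symmetric])
  have s_nonneg: "?s x \<ge> 0" for x
    using series_integrand_eq_nn_integral(1)[OF a] by (auto split: split_indicator)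
  have "?s = (\<lambda>x. indicator {0<..} x *\<^sub>R enn2real (G x))"
    using G_eq series_integrand_eq_nn_integral(1)[OF a]
    by (auto simp: fun_eq_iff split: split_indicator)
  then have meas: "?s \<in> borel_measurable lborel"
    by simp
  have "(\<integral>\<^sup>+x. ennreal (?s x) \<partial>lborel) = (\<integral>\<^sup>+x\<in>{0<..}. ennreal (series_integrand a b n x) \<partial>lborel)"
    unfolding nn_integral_set_ennreal by (simp add: mult.commute)
  also have "\<dots> = (\<integral>\<^sup>+w\<in>{?r<..}. ennreal (2 * sqrt pi * exp (- 2 * sqrt b * w) / (a + w\<^sup>2) ^ n) \<partial>lborel)"
    by (rule nn_integral_series_integrand[OF a b])
  also have "\<dots> \<le> (\<integral>\<^sup>+w. ennreal (2 * sqrt pi) * (ennreal (exp (- (2 * sqrt b * w))) * indicator {0<..} w) \<partial>lborel)"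
  proof (intro nn_integral_mono)
    fix w :: real
    show "ennreal (2 * sqrt pi * exp (- 2 * sqrt b * w) / (a + w\<^sup>2) ^ n) * indicator {?r<..} w
        \<le> ennreal (2 * sqrt pi) * (ennreal (exp (- (2 * sqrt b * w))) * indicator {0<..} w)"
    proof (cases "w > ?r")
      case True
      have "?r\<^sup>2 \<le> w\<^sup>2" using True r by (intro power_mono) auto
      then have "(a + w\<^sup>2) ^ n \<ge> 1" using a by (intro one_le_power) simp
      then have "2 * sqrt pi * exp (- 2 * sqrt b * w) / (a + w\<^sup>2) ^ n \<le> 2 * sqrt pi * exp (- 2 * sqrt b * w) / 1"
        by (intro divide_left_mono) auto
      then show ?thesis
        using True le_less_trans[OF r True] by (simp add: ennreal_mult'[symmetric] ennreal_leI)
    qed simp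
  qed
  also have "\<dots> = ennreal (2 * sqrt pi) * ennreal (1 / (2 * sqrt b))"
    using b by (subst nn_integral_cmult) (simp_all add: nn_integral_exp_greaterThan)
  also have "\<dots> < \<infinity>"
    by (simp add: ennreal_mult_less_top)
  finally have int: "integrable lborel ?s"
    by (intro integrableI_nonneg meas AE_I2 s_nonneg)
  then show "set_integrable lborel {0<..} (series_integrand a b n)"
    by (simp add: set_integrable_def)
  show "0 \<le> (LBINT x:{0<..}. series_integrand a b n x)"
    unfolding set_lebesgue_integral_def by (rule Bochner_Integration.integral_nonneg) (rule s_nonneg)
  show "(\<integral>\<^sup>+x\<in>{0<..}. ennreal (series_integrand a b n x) \<partial>lborel) =
      ennreal (LBINT x:{0<..}. series_integrand a b n x)"
    unfolding set_lebesgue_integral_def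
    unfolding nn_integral_eq_integral[OF int AE_I2[OF s_nonneg], symmetric] nn_integral_set_ennreal
    by (simp add: mult.commute)
qed

lemma series_term_ennreal_eq:
  fixes a b c :: real
  assumes a: "0 < a" "a \<le> 1" and b: "0 < b" and c: "0 < c"
  shows "0 \<le> series_term a b c n" and "series_term_ennreal a b c n = ennreal (series_term a b c n)"
  using series_integrand_integrable(2,3)[OF a b] c
  by (auto simp: series_term_def series_term_ennreal_def simp flip: ennreal_mult')

text \<open>
For \<open>u \<ge> sqrt (1 - a)\<close> the denominator is at least \<open>c - 1 > 0\<close>.
\<close>

lemma nn_integral_exp_over_quadratic_finite:
  fixes a b c :: real
  assumes a: "0 < a" "a \<le> 1" and b: "0 < b" and c: "1 < c"
  shows "(\<integral>\<^sup>+u\<in>{sqrt (1 - a)..}. ennreal (exp (- 2 * sqrt b * u) / (c * u\<^sup>2 + a * c - 1)) \<partial>lborel) < \<infinity>"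
proof -
  let ?r = "sqrt (1 - a)"
  have r: "?r \<ge> 0" using a by simp
  have "(\<integral>\<^sup>+u\<in>{?r..}. ennreal (exp (- 2 * sqrt b * u) / (c * u\<^sup>2 + a * c - 1)) \<partial>lborel)
      \<le> (\<integral>\<^sup>+u. ennreal (1 / (c - 1)) * (ennreal (exp (- (2 * sqrt b * u))) * indicator {0<..} u) \<partial>lborel)"
    unfolding nn_integral_atLeast_eq_greaterThan
  proof (intro nn_integral_mono)
    fix u :: real
    show "ennreal (exp (- 2 * sqrt b * u) / (c * u\<^sup>2 + a * c - 1)) * indicator {?r<..} u
        \<le> ennreal (1 / (c - 1)) * (ennreal (exp (- (2 * sqrt b * u))) * indicator {0<..} u)"
    proof (cases "u > ?r")
      case True
      have "?r\<^sup>2 \<le> u\<^sup>2" using True r by (intro power_mono) auto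
      then have "c * (1 - a) \<le> c * u\<^sup>2" using a c by (intro mult_left_mono) auto
      then have "c - 1 \<le> c * u\<^sup>2 + a * c - 1" by (simp add: algebra_simps)
      then have "exp (- 2 * sqrt b * u) / (c * u\<^sup>2 + a * c - 1) \<le> exp (- 2 * sqrt b * u) / (c - 1)"
        using c by (intro divide_left_mono mult_pos_pos) auto
      then show ?thesis
        using True le_less_trans[OF r True] c by (simp add: ennreal_mult'[symmetric] ennreal_leI)
    qed simp
  qed
  also have "\<dots> = ennreal (1 / (c - 1)) * ennreal (1 / (2 * sqrt b))"
    using b by (subst nn_integral_cmult) (simp_all add: nn_integral_exp_greaterThan)
  also have "\<dots> < \<infinity>"
    by (simp add: ennreal_mult_less_top)
  finally show ?thesis .
qed

text \<open>
For \<open>0 < t \<le> 1\<close> the part over \<open>{0<..t}\<close> alone contributes at least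
\<open>exp (- 2 * sqrt b) / t\<close>.
\<close>

lemma nn_integral_exp_over_square_infinite:
  fixes b :: real
  assumes b: "0 < b"
  shows "(\<integral>\<^sup>+u\<in>{0..}. ennreal (exp (- 2 * sqrt b * u) / u\<^sup>2) \<partial>lborel) = \<infinity>"
proof (rule ccontr)
  let ?I = "\<integral>\<^sup>+u\<in>{0..}. ennreal (exp (- 2 * sqrt b * u) / u\<^sup>2) \<partial>lborel"
  define K where "K = exp (- 2 * sqrt b)"
  have K: "K > 0" by (simp add: K_def)
  have ge: "ennreal (K / t) \<le> ?I" if t: "0 < t" "t \<le> 1" for t
  proof -
    have "ennreal (K / t) = ennreal (K / t\<^sup>2) * emeasure lborel {0<..t}"
      using t K by (simp add: ennreal_mult'[symmetric] power2_eq_square)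
    also have "\<dots> = (\<integral>\<^sup>+u. ennreal (K / t\<^sup>2) * indicator {0<..t} u \<partial>lborel)"
      by (rule nn_integral_cmult_indicator[symmetric]) simp
    also have "\<dots> \<le> ?I"
    proof (intro nn_integral_mono)
      fix u :: real
      have "K / t\<^sup>2 \<le> exp (- 2 * sqrt b * u) / u\<^sup>2" if "0 < u" "u \<le> t"
      proof (rule frac_le)
        show "K \<le> exp (- 2 * sqrt b * u)"
          unfolding K_def using that t b mult_left_mono[of u 1 "sqrt b"] by simp
        show "u\<^sup>2 \<le> t\<^sup>2" using that by (intro power_mono) auto
      qed (use that in auto)
      then show "ennreal (K / t\<^sup>2) * indicator {0<..t} u
          \<le> ennreal (exp (- 2 * sqrt b * u) / u\<^sup>2) * indicator {0..} u"
        by (auto split: split_indicator intro: ennreal_leI)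
    qed
    finally show ?thesis .
  qed
  assume "?I \<noteq> \<infinity>"
  then obtain m where m: "m \<ge> 0" "?I = ennreal m"
    by (cases ?I) auto
  define t where "t = min 1 (K / (m + 1))"
  have t: "0 < t" "t \<le> 1" "t \<le> K / (m + 1)"
    using K m by (auto simp: t_def)
  then have "m + 1 \<le> K / t"
    using m by (simp add: field_simps)
  moreover have "K / t \<le> m"
    using ge[OF t(1,2)] K t m by simp
  ultimately show False by simp
qed

lemma series_summable_and_suminf:
  fixes a b c :: real
  assumes a: "0 < a" "a \<le> 1" and b: "0 < b" and c: "1 / a \<le> c" "1 < c"
  shows "summable (\<lambda>n. series_term a b c (Suc n))"
    and "ennreal (\<Sum>n. series_term a b c (Suc n)) = ennreal (2 * sqrt pi) *
      (\<integral>\<^sup>+u\<in>{sqrt (1 - a)..}. ennreal (exp (- 2 * sqrt b * u) / (c * u\<^sup>2 + a * c - 1)) \<partial>lborel)"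
proof -
  let ?I = "\<integral>\<^sup>+u\<in>{sqrt (1 - a)..}. ennreal (exp (- 2 * sqrt b * u) / (c * u\<^sup>2 + a * c - 1)) \<partial>lborel"
  have c0: "0 < c" using c by simp
  note t = series_term_ennreal_eq[OF a b c0]
  have sum: "(\<Sum>n. ennreal (series_term a b c (Suc n))) = ennreal (2 * sqrt pi) * ?I"
    using suminf_series_term_ennreal[OF a b c(1)] by (simp add: t(2))
  moreover have "ennreal (2 * sqrt pi) * ?I < \<infinity>"
    using nn_integral_exp_over_quadratic_finite[OF a b c(2)] by (simp add: ennreal_mult_less_top)
  ultimately show s: "summable (\<lambda>n. series_term a b c (Suc n))"
    using t(1) by (intro summable_suminf_not_top) auto
  show "ennreal (\<Sum>n. series_term a b c (Suc n)) = ennreal (2 * sqrt pi) * ?I"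
    unfolding sum[symmetric] by (rule suminf_ennreal2[symmetric]) (use s t(1) in auto)
qed

lemma series_not_summable:
  fixes b :: real
  assumes b: "0 < b"
  shows "\<not> summable (\<lambda>n. series_term 1 b 1 (Suc n))"
proof
  assume "summable (\<lambda>n. series_term 1 b 1 (Suc n))"
  then have "(\<Sum>n. ennreal (series_term 1 b 1 (Suc n))) = ennreal (\<Sum>n. series_term 1 b 1 (Suc n))"
    by (intro suminf_ennreal2) (simp_all add: series_term_ennreal_eq b)
  moreover have "(\<Sum>n. ennreal (series_term 1 b 1 (Suc n))) = \<infinity>"
    using suminf_series_term_ennreal[of 1 b 1] nn_integral_exp_over_square_infinite[OF b] b
    by (simp add: series_term_ennreal_eq(2) ennreal_mult_top)
  ultimately show False by simp
qed

lemma series_sums_integral: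
  fixes b c :: real
  assumes b: "0 < b" and c: "1 < c"
  shows "set_integrable lborel {0<..} (\<lambda>u. exp (- 2 * sqrt b * u) / (c * u\<^sup>2 + c - 1))"
    and "(\<lambda>n. series_term 1 b c (Suc n)) sums
          (2 * sqrt pi * (LBINT u:{0<..}. exp (- 2 * sqrt b * u) / (c * u\<^sup>2 + c - 1)))"
proof -
  define f where "f u = exp (- 2 * sqrt b * u) / (c * u\<^sup>2 + c - 1)" for u
  have f_meas: "f \<in> borel_measurable borel" unfolding f_def by measurable
  have f_nonneg: "f u \<ge> 0" for u
  proof -
    have "0 \<le> c * u\<^sup>2" using c by simp
    then have "0 \<le> c * u\<^sup>2 + c - 1" using c by linarith
    then show ?thesis unfolding f_def by (intro divide_nonneg_nonneg) auto
  qed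
  have I: "(\<integral>\<^sup>+u\<in>{sqrt (1 - 1)..}. ennreal (exp (- 2 * sqrt b * u) / (c * u\<^sup>2 + 1 * c - 1)) \<partial>lborel)
      = (\<integral>\<^sup>+u. ennreal (indicator {0<..} u *\<^sub>R f u) \<partial>lborel)"
    unfolding nn_integral_atLeast_eq_greaterThan
    by (intro nn_integral_cong) (auto simp: f_def split: split_indicator)
  have "(\<integral>\<^sup>+u. ennreal (indicator {0<..} u *\<^sub>R f u) \<partial>lborel) < \<infinity>"
    using nn_integral_exp_over_quadratic_finite[of 1 b c] b c unfolding I by simp
  then have int: "integrable lborel (\<lambda>u. indicator {0<..} u *\<^sub>R f u)"
    using f_meas by (intro integrableI_nonneg) (auto simp: f_nonneg)
  then show "set_integrable lborel {0<..} (\<lambda>u. exp (- 2 * sqrt b * u) / (c * u\<^sup>2 + c - 1))"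
    unfolding set_integrable_def f_def .
  have J: "(LBINT u:{0<..}. f u) \<ge> 0"
    unfolding set_lebesgue_integral_def by (intro Bochner_Integration.integral_nonneg) (simp add: f_nonneg)
  have "(\<integral>\<^sup>+u. ennreal (indicator {0<..} u *\<^sub>R f u) \<partial>lborel) = ennreal (LBINT u:{0<..}. f u)"
    unfolding set_lebesgue_integral_def
    by (rule nn_integral_eq_integral[OF int]) (simp add: f_nonneg)
  then have "ennreal (\<Sum>n. series_term 1 b c (Suc n)) = ennreal (2 * sqrt pi * (LBINT u:{0<..}. f u))"
    using series_summable_and_suminf(2)[of 1 b c] b c J unfolding I by (simp add: ennreal_mult)
  moreover have "0 \<le> (\<Sum>n. series_term 1 b c (Suc n))"
    using series_summable_and_suminf(1)[of 1 b c] b c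
    by (intro suminf_nonneg series_term_ennreal_eq(1)) auto
  ultimately have "(\<Sum>n. series_term 1 b c (Suc n)) = 2 * sqrt pi * (LBINT u:{0<..}. f u)"
    using J by simp
  then show "(\<lambda>n. series_term 1 b c (Suc n)) sums
          (2 * sqrt pi * (LBINT u:{0<..}. exp (- 2 * sqrt b * u) / (c * u\<^sup>2 + c - 1)))"
    using summable_sums[OF series_summable_and_suminf(1)[of 1 b c]] b c by (simp add: f_def)
qed

section \<open>The sine and cosine integrals as Laplace integrals\<close>

text \<open>
As a function of \<open>t\<close>, the negative of this kernel is an antiderivative of
\<open>sin (t + \<phi>) * exp (- (u * t))\<close>. Integrated over \<open>u > 0\<close> it therefore gives the tail
integral of \<open>sin (s + \<phi>) / s\<close> over \<open>s > t\<close>. The phase \<open>\<phi>\<close> treats the sine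
integral (\<open>\<phi> = 0\<close>) and the cosine integral (\<open>\<phi> = pi / 2\<close>) together.
\<close>

definition sine_tail_kernel :: "real \<Rightarrow> real \<Rightarrow> real \<Rightarrow> real" where
  "sine_tail_kernel \<phi> t u = exp (- (u * t)) * (u * sin (t + \<phi>) + cos (t + \<phi>)) / (1 + u\<^sup>2)"

lemma sine_tail_kernel_measurable [measurable]: "sine_tail_kernel \<phi> t \<in> borel_measurable borel"
  unfolding sine_tail_kernel_def by measurable

lemma abs_sine_tail_kernel_le:
  assumes "0 < u"
  shows "\<bar>sine_tail_kernel \<phi> t u\<bar> \<le> 2 * exp (- (u * t))"
proof -
  have "\<bar>u * sin (t + \<phi>) + cos (t + \<phi>)\<bar> \<le> \<bar>u * sin (t + \<phi>)\<bar> + \<bar>cos (t + \<phi>)\<bar>"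
    by (rule abs_triangle_ineq)
  also have "\<dots> \<le> u * 1 + 1"
    using assms unfolding abs_mult by (intro add_mono mult_mono) auto
  also have "\<dots> \<le> 2 * (1 + u\<^sup>2)"
  proof -
    have "2 * u \<le> u\<^sup>2 + 1" using sum_squares_bound[of u 1] by simp
    moreover have "0 \<le> u\<^sup>2" by simp
    ultimately have "2 * (u + 1) \<le> 2 * (2 + 2 * u\<^sup>2)" unfolding distrib_left by linarith
    then show ?thesis by simp
  qed
  finally have "\<bar>u * sin (t + \<phi>) + cos (t + \<phi>)\<bar> / (1 + u\<^sup>2) \<le> 2"
    by (subst pos_divide_le_eq) (auto simp: add_pos_nonneg)
  then have "exp (- (u * t)) * (\<bar>u * sin (t + \<phi>) + cos (t + \<phi>)\<bar> / (1 + u\<^sup>2)) \<le> exp (- (u * t)) * 2"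
    by (intro mult_left_mono) auto
  moreover have "\<bar>sine_tail_kernel \<phi> t u\<bar> = exp (- (u * t)) * (\<bar>u * sin (t + \<phi>) + cos (t + \<phi>)\<bar> / (1 + u\<^sup>2))"
    by (simp add: sine_tail_kernel_def abs_mult)
  ultimately show ?thesis
    by (simp only: mult.commute)
qed

lemma sine_tail_kernel_integrable:
  assumes "0 < t"
  shows "set_integrable lborel {0<..} (sine_tail_kernel \<phi> t)"
    and "\<bar>LBINT u:{0<..}. sine_tail_kernel \<phi> t u\<bar> \<le> 2 / t"
proof -
  have e: "set_integrable lborel {0<..} (\<lambda>u. 2 * exp (- (u * t)))"
    by (intro set_integrable_mult_right integrable_I0i_exp_mscale assms)
  show int: "set_integrable lborel {0<..} (sine_tail_kernel \<phi> t)"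
    unfolding set_integrable_def
    by (rule Bochner_Integration.integrable_bound[OF e[unfolded set_integrable_def]])
       (auto simp: abs_sine_tail_kernel_le split: split_indicator)
  have "\<bar>LBINT u:{0<..}. sine_tail_kernel \<phi> t u\<bar> \<le> (LBINT u:{0<..}. \<bar>sine_tail_kernel \<phi> t u\<bar>)"
    using integral_norm_bound[of lborel "\<lambda>u. indicator {0<..} u *\<^sub>R sine_tail_kernel \<phi> t u"]
    by (simp add: set_lebesgue_integral_def abs_mult)
  also have "\<dots> \<le> (LBINT u:{0<..}. 2 * exp (- (u * t)))"
    using set_integrable_abs[OF int] e unfolding set_integrable_def set_lebesgue_integral_def
    by (intro integral_mono) (auto simp: abs_sine_tail_kernel_le split: split_indicator)
  also have "\<dots> = 2 / t"
    using LBINT_I0i_exp_mscale[OF assms] by (simp add: interval_lebesgue_integral_0_infty)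
  finally show "\<bar>LBINT u:{0<..}. sine_tail_kernel \<phi> t u\<bar> \<le> 2 / t" .
qed

text \<open>
Write \<open>1 / t\<close> as the integral of \<open>exp (- (u * t))\<close> over \<open>u > 0\<close> and integrate over
\<open>t\<close> first. Fubini applies since on \<open>{z..T}\<close> the absolute values integrate to that of
the continuous function \<open>\<bar>sin (t + \<phi>)\<bar> / t\<close>; only the limit \<open>T \<rightarrow> \<infinity>\<close> is
conditional, and it is taken afterwards.
\<close>

lemma integral_sin_shift_over_id:
  assumes z: "0 < z" and T: "z \<le> T"
  shows "(LBINT t=ereal z..ereal T. sin (t + \<phi>) / t)
    = (LBINT u:{0<..}. sine_tail_kernel \<phi> z u) - (LBINT u:{0<..}. sine_tail_kernel \<phi> T u)"
proof -
  let ?f = "\<lambda>t u. indicator {z..T} t * (indicator {0<..} u * (sin (t + \<phi>) * exp (- (u * t))))"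
  have exp_int: "(LBINT u. indicator {0<..} u * exp (- (u * t))) = 1 / t" if "t > 0" for t :: real
    using LBINT_I0i_exp_mscale[OF that]
    by (simp add: interval_lebesgue_integral_0_infty set_lebesgue_integral_def)
  have inner_u: "(LBINT u. indicator {z..T} t * (indicator {0<..} u * (s * exp (- (u * t)))))
      = indicator {z..T} t * (s / t)" for t s :: real
  proof (cases "t \<in> {z..T}")
    case True
    then have "t > 0" using z by simp
    have "(LBINT u. indicator {z..T} t * (indicator {0<..} u * (s * exp (- (u * t)))))
        = (LBINT u. s * (indicator {0<..} u * exp (- (u * t))))"
      using True by (intro Bochner_Integration.integral_cong) (auto simp: mult_ac)
    also have "\<dots> = s * (1 / t)"
      unfolding integral_mult_right_zero exp_int[OF \<open>t > 0\<close>] ..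
    finally show ?thesis using True by simp
  qed simp
  have inner_t: "(LBINT t. ?f t u) = indicator {0<..} u * (sine_tail_kernel \<phi> z u - sine_tail_kernel \<phi> T u)" for u
  proof -
    have "(LBINT t=ereal z..ereal T. sin (t + \<phi>) * exp (- (u * t)))
        = (- sine_tail_kernel \<phi> T u) - (- sine_tail_kernel \<phi> z u)"
    proof (rule interval_integral_FTC_finite)
      fix t
      define D where "D = 1 + u\<^sup>2"
      have D: "D \<noteq> 0" unfolding D_def by (smt (verit) zero_le_power2)
      have "((\<lambda>t. exp (- (u * t)) * (u * sin (t + \<phi>) + cos (t + \<phi>))) has_real_derivative
          - (D * (sin (t + \<phi>) * exp (- (u * t))))) (at t within {min z T..max z T})"
        by (auto intro!: derivative_eq_intros simp: D_def algebra_simps power2_eq_square)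
      from DERIV_minus[OF DERIV_cdivide[OF this, of D]]
      have "((\<lambda>t. - sine_tail_kernel \<phi> t u) has_real_derivative sin (t + \<phi>) * exp (- (u * t)))
          (at t within {min z T..max z T})"
        using D by (simp add: sine_tail_kernel_def flip: D_def)
      then show "((\<lambda>t. - sine_tail_kernel \<phi> t u) has_vector_derivative sin (t + \<phi>) * exp (- (u * t)))
          (at t within {min z T..max z T})"
        by (simp add: has_real_derivative_iff_has_vector_derivative)
    qed (auto intro!: continuous_intros)
    moreover have "(LBINT t. ?f t u) = indicator {0<..} u * (LBINT t=ereal z..ereal T. sin (t + \<phi>) * exp (- (u * t)))"
      unfolding interval_integral_Icc[OF T] set_lebesgue_integral_def integral_mult_right_zero[symmetric]
      by (intro Bochner_Integration.integral_cong) (auto simp: mult_ac)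
    ultimately show ?thesis by simp
  qed
  have "(LBINT t=ereal z..ereal T. sin (t + \<phi>) / t) = (LBINT t. LBINT u. ?f t u)"
    unfolding inner_u interval_integral_Icc[OF T] set_lebesgue_integral_def by simp
  also have "\<dots> = (LBINT u. LBINT t. ?f t u)"
  proof (intro lborel_pair.Fubini_integral[symmetric] lborel_pair.Fubini_integrable)
    show "case_prod ?f \<in> borel_measurable (lborel \<Otimes>\<^sub>M lborel)"
      by measurable
    have "(LBINT u. norm (case_prod ?f (t, u))) = indicator {z..T} t * (\<bar>sin (t + \<phi>)\<bar> / t)" for t
      unfolding inner_u[symmetric]
      by (intro Bochner_Integration.integral_cong) (auto simp: abs_mult)
    moreover have "integrable lborel (\<lambda>t. indicator {z..T} t *\<^sub>R (\<bar>sin (t + \<phi>)\<bar> / t))"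
      using z by (intro borel_integrable_compact continuous_intros) auto
    ultimately show "integrable lborel (\<lambda>t. LBINT u. norm (case_prod ?f (t, u)))"
      by simp
    show "AE t in lborel. integrable lborel (\<lambda>u. case_prod ?f (t, u))"
    proof (rule AE_I2)
      fix t :: real
      show "integrable lborel (\<lambda>u. case_prod ?f (t, u))"
      proof (cases "t \<in> {z..T}")
        case True
        then have "t > 0" using z by simp
        then have "set_integrable lborel {0<..} (\<lambda>u. sin (t + \<phi>) * exp (- (u * t)))"
          by (intro set_integrable_mult_right integrable_I0i_exp_mscale)
        then show ?thesis using True by (simp add: set_integrable_def)
      qed simp
    qed
  qed
  also have "\<dots> = (LBINT u:{0<..}. sine_tail_kernel \<phi> z u - sine_tail_kernel \<phi> T u)"
    unfolding inner_t set_lebesgue_integral_def by simp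
  also have "\<dots> = (LBINT u:{0<..}. sine_tail_kernel \<phi> z u) - (LBINT u:{0<..}. sine_tail_kernel \<phi> T u)"
    using z T by (intro set_integral_diff sine_tail_kernel_integrable) auto
  finally show ?thesis .
qed

lemma integral_sin_shift_over_id_at_top:
  assumes z: "0 < z"
  shows "((\<lambda>T. LBINT t=ereal z..ereal T. sin (t + \<phi>) / t) \<longlongrightarrow> (LBINT u:{0<..}. sine_tail_kernel \<phi> z u)) at_top"
proof -
  let ?H = "\<lambda>T. LBINT u:{0<..}. sine_tail_kernel \<phi> T u"
  have "(?H \<longlongrightarrow> 0) at_top"
  proof (rule Lim_null_comparison)
    show "\<forall>\<^sub>F T in at_top. norm (?H T) \<le> 2 / T"
      using eventually_gt_at_top[of 0] by eventually_elim (simp add: sine_tail_kernel_integrable)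
    show "((\<lambda>T::real. 2 / T) \<longlongrightarrow> 0) at_top"
      by (intro tendsto_divide_0[OF tendsto_const] filterlim_at_top_imp_at_infinity filterlim_ident)
  qed
  then have "((\<lambda>T. ?H z - ?H T) \<longlongrightarrow> ?H z - 0) at_top"
    by (intro tendsto_diff tendsto_const)
  moreover have "\<forall>\<^sub>F T in at_top. ?H z - ?H T = (LBINT t=ereal z..ereal T. sin (t + \<phi>) / t)"
    using eventually_ge_at_top[of z] by eventually_elim (simp add: integral_sin_shift_over_id[OF z])
  ultimately show ?thesis
    by (auto intro: Lim_transform_eventually)
qed

lemma Ci_eq_laplace:
  assumes "0 < z"
  shows "Ci z = - (LBINT u:{0<..}. sine_tail_kernel (pi / 2) z u)"
  using integral_sin_shift_over_id_at_top[OF assms, of "pi / 2"]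
  by (simp add: Ci_def sin_add tendsto_Lim)

lemma Si_eq_laplace:
  assumes z: "0 < z"
  shows "pi / 2 - Si z = (LBINT u:{0<..}. sine_tail_kernel 0 z u)"
proof (rule tendsto_unique)
  show "((\<lambda>T. LBINT t=ereal z..ereal T. sin t / t) \<longlongrightarrow> (LBINT u:{0<..}. sine_tail_kernel 0 z u)) at_top"
    using integral_sin_shift_over_id_at_top[OF z, of 0] by simp
  have "\<forall>\<^sub>F T in at_top. Si T - Si z = (LBINT t=ereal z..ereal T. sin t / t)"
    using eventually_ge_at_top[of z]
  proof eventually_elim
    case (elim T)
    show ?case
    proof (rule interval_integral_FTC_finite[symmetric])
      fix t assume "min z T \<le> t"
      then have "t \<noteq> 0" using z elim by auto
      then show "(Si has_vector_derivative sin t / t) (at t within {min z T..max z T})"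
        using DERIV_Si[of t]
        by (auto simp: has_real_derivative_iff_has_vector_derivative intro: has_vector_derivative_at_within)
    qed (use z elim in \<open>auto intro!: continuous_intros\<close>)
  qed
  moreover have "((\<lambda>T. Si T - Si z) \<longlongrightarrow> pi / 2 - Si z) at_top"
    by (intro tendsto_diff Si_at_top tendsto_const)
  ultimately show "((\<lambda>T. LBINT t=ereal z..ereal T. sin t / t) \<longlongrightarrow> pi / 2 - Si z) at_top"
    by (rule Lim_transform_eventually[rotated])
qed simp

text \<open>
Rotating the pair of kernels with phases \<open>0\<close> and \<open>pi / 2\<close> by the angle \<open>z\<close> removes all
trigonometric factors: the coefficients of \<open>u\<close> cancel and the others add up to
\<open>(sin z)\<^sup>2 + (cos z)\<^sup>2 = 1\<close>.
\<close>

lemma laplace_inverse_1_plus_square: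
  assumes z: "0 < z"
  shows "(LBINT u:{0<..}. exp (- (u * z)) / (1 + u\<^sup>2)) = sin z * Ci z + cos z * (pi / 2 - Si z)"
proof -
  have "exp (- (u * z)) / (1 + u\<^sup>2) = cos z * sine_tail_kernel 0 z u - sin z * sine_tail_kernel (pi / 2) z u" for u
  proof -
    have "cos z * (u * sin z + cos z) - sin z * (u * cos z - sin z) = (sin z)\<^sup>2 + (cos z)\<^sup>2"
      by (simp add: algebra_simps power2_eq_square)
    then have "exp (- (u * z)) / (1 + u\<^sup>2)
        = exp (- (u * z)) * (cos z * (u * sin z + cos z) - sin z * (u * cos z - sin z)) / (1 + u\<^sup>2)"
      by simp
    also have "\<dots> = cos z * sine_tail_kernel 0 z u - sin z * sine_tail_kernel (pi / 2) z u"
      by (simp add: sine_tail_kernel_def sin_add cos_add diff_divide_distrib right_diff_distrib mult_ac)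
    finally show ?thesis .
  qed
  then have "(LBINT u:{0<..}. exp (- (u * z)) / (1 + u\<^sup>2))
      = (LBINT u:{0<..}. cos z * sine_tail_kernel 0 z u - sin z * sine_tail_kernel (pi / 2) z u)"
    by simp
  also have "\<dots> = cos z * (LBINT u:{0<..}. sine_tail_kernel 0 z u) - sin z * (LBINT u:{0<..}. sine_tail_kernel (pi / 2) z u)"
    using z by (subst set_integral_diff) (auto intro!: set_integrable_mult_right sine_tail_kernel_integrable)
  finally show ?thesis
    by (simp add: Ci_eq_laplace[OF z] Si_eq_laplace[OF z])
qed

text \<open>
Scaling \<open>u = \<gamma> * t\<close> with \<open>c * \<gamma>\<^sup>2 = c - 1\<close> turns the denominator into
\<open>(c - 1) * (1 + t\<^sup>2)\<close> and the exponent into \<open>- t * ell b c\<close>.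
\<close>

lemma laplace_inverse_quadratic:
  fixes b c :: real
  assumes b: "0 < b" and c: "1 < c"
  shows "2 * sqrt pi * (LBINT u:{0<..}. exp (- 2 * sqrt b * u) / (c * u\<^sup>2 + c - 1)) =
          sqrt (pi / (c * (c - 1))) *
          (2 * sin (ell b c) * Ci (ell b c) + cos (ell b c) * (pi - 2 * Si (ell b c)))"
proof -
  define \<gamma> where "\<gamma> = sqrt ((c - 1) / c)"
  have \<gamma>: "\<gamma> > 0" "c * \<gamma>\<^sup>2 = c - 1"
    using c by (auto simp: \<gamma>_def)
  have ell: "ell b c = 2 * sqrt b * \<gamma>"
    unfolding ell_def \<gamma>_def real_sqrt_mult[symmetric] mult.assoc times_divide_eq_right ..
  then have z: "ell b c > 0" using b \<gamma> by simp
  let ?g = "\<lambda>u. indicator {0<..} u * (exp (- 2 * sqrt b * u) / (c * u\<^sup>2 + c - 1))"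
  have "(LBINT u:{0<..}. exp (- 2 * sqrt b * u) / (c * u\<^sup>2 + c - 1)) = (LBINT u. ?g u)"
    by (simp add: set_lebesgue_integral_def)
  also have "\<dots> = \<gamma> * (LBINT t. ?g (\<gamma> * t))"
    using lborel_integral_real_affine[of \<gamma> ?g 0] \<gamma>(1) by simp
  also have "\<dots> = \<gamma> * (LBINT t. (1 / (c - 1)) * (indicator {0<..} t *\<^sub>R (exp (- (t * ell b c)) / (1 + t\<^sup>2))))"
  proof (intro arg_cong[where f = "\<lambda>x. \<gamma> * x"] Bochner_Integration.integral_cong refl)
    fix t :: real
    have "c * (\<gamma> * t)\<^sup>2 + c - 1 = (c - 1) * (1 + t\<^sup>2)"
      unfolding power_mult_distrib mult.assoc[symmetric] \<gamma>(2) by (simp add: algebra_simps)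
    then show "?g (\<gamma> * t) = (1 / (c - 1)) * (indicator {0<..} t *\<^sub>R (exp (- (t * ell b c)) / (1 + t\<^sup>2)))"
      using \<gamma>(1) by (auto simp: ell zero_less_mult_iff mult_ac split: split_indicator)
  qed
  also have "\<dots> = (\<gamma> / (c - 1)) * (LBINT u:{0<..}. exp (- (u * ell b c)) / (1 + u\<^sup>2))"
    unfolding integral_mult_right_zero by (simp add: set_lebesgue_integral_def)
  also have "\<gamma> / (c - 1) = 1 / sqrt (c * (c - 1))"
  proof -
    have cancel: "(p / s) / (p * p) = 1 / (s * p)" if "p > 0" for p s :: real
      using that by simp
    have p: "sqrt (c - 1) > 0" "c - 1 = sqrt (c - 1) * sqrt (c - 1)"
      using c by auto
    have "\<gamma> / (c - 1) = (sqrt (c - 1) / sqrt c) / (sqrt (c - 1) * sqrt (c - 1))"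
      unfolding \<gamma>_def real_sqrt_divide p(2)[symmetric] ..
    also have "\<dots> = 1 / (sqrt c * sqrt (c - 1))"
      using cancel[OF p(1)] .
    finally show ?thesis by (simp add: real_sqrt_mult)
  qed
  finally have I: "(LBINT u:{0<..}. exp (- 2 * sqrt b * u) / (c * u\<^sup>2 + c - 1))
      = 1 / sqrt (c * (c - 1)) * (sin (ell b c) * Ci (ell b c) + cos (ell b c) * (pi / 2 - Si (ell b c)))"
    unfolding laplace_inverse_1_plus_square[OF z] .
  have "2 * p * (1 / d * (s * C + k * (q / 2 - S))) = p / d * (2 * s * C + k * (q - 2 * S))"
    for p d s C k q S :: real
    by (cases "d = 0") (simp_all add: field_simps)
  then show ?thesis
    unfolding I real_sqrt_divide .
qed

section \<open>The series identities\<close>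

theorem theorem1p1:
  shows
    "(\<forall>a\<in>{0<..1}. \<forall>b\<in>{0<..}. \<forall>c\<in>{1 / a..}.
        (\<Sum>n. series_term_ennreal a b c (Suc n)) =
          ennreal (2 * sqrt pi) *
          (\<integral>\<^sup>+ u\<in>{sqrt (1 - a)..}.
             ennreal (exp (- 2 * sqrt b * u) / (c * u\<^sup>2 + a * c - 1)) \<partial>lborel)
      \<and> (\<forall>(M :: 'm measure) \<xi>.
          prob_space M \<longrightarrow>
          distributed M lborel \<xi> (\<lambda>u. ennreal (exponential_density (2 * sqrt b) u)) \<longrightarrow>
          ennreal (2 * sqrt pi) *
          (\<integral>\<^sup>+ u\<in>{sqrt (1 - a)..}.
             ennreal (exp (- 2 * sqrt b * u) / (c * u\<^sup>2 + a * c - 1)) \<partial>lborel) =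
          ennreal (sqrt (pi / b)) *
          (\<integral>\<^sup>+ \<omega>. ennreal (inverse (c * (\<xi> \<omega>)\<^sup>2 + a * c - 1)
             * indicator {\<omega>. \<xi> \<omega> \<ge> sqrt (1 - a)} \<omega>) \<partial>M)))
     \<and>
     (\<forall>b\<in>{0<..}.
        (\<forall>a\<in>{0<..<1}. \<forall>c\<in>{1 / a..}.
            terms_well_defined a b \<and> summable (\<lambda>n. series_term a b c (Suc n)))
      \<and> (\<forall>c\<in>{1<..}.
            terms_well_defined 1 b \<and> summable (\<lambda>n. series_term 1 b c (Suc n)))
      \<and> (terms_well_defined 1 b \<and> \<not> summable (\<lambda>n. series_term 1 b 1 (Suc n))))
     \<and>
     (\<forall>b\<in>{0<..}. \<forall>c\<in>{1<..}.
        terms_well_defined 1 b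
      \<and> set_integrable lborel {0<..} (\<lambda>u. exp (- 2 * sqrt b * u) / (c * u\<^sup>2 + c - 1))
      \<and> (\<lambda>n. series_term 1 b c (Suc n)) sums
          (2 * sqrt pi * (LBINT u:{0<..}. exp (- 2 * sqrt b * u) / (c * u\<^sup>2 + c - 1)))
      \<and> 2 * sqrt pi * (LBINT u:{0<..}. exp (- 2 * sqrt b * u) / (c * u\<^sup>2 + c - 1)) =
          sqrt (pi / (c * (c - 1))) *
          (2 * sin (ell b c) * Ci (ell b c) + cos (ell b c) * (pi - 2 * Si (ell b c))))"
proof (intro conjI ballI allI impI)
  fix a b c :: real
  assume "a \<in> {0<..1}" "b \<in> {0<..}" "c \<in> {1 / a..}"
  then have a: "0 < a" "a \<le> 1" and b: "0 < b" and c: "1 / a \<le> c" by auto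
  show "(\<Sum>n. series_term_ennreal a b c (Suc n)) =
          ennreal (2 * sqrt pi) *
          (\<integral>\<^sup>+ u\<in>{sqrt (1 - a)..}.
             ennreal (exp (- 2 * sqrt b * u) / (c * u\<^sup>2 + a * c - 1)) \<partial>lborel)"
    by (rule suminf_series_term_ennreal[OF a b c])
  fix M :: "'m measure" and \<xi>
  assume "distributed M lborel \<xi> (\<lambda>u. ennreal (exponential_density (2 * sqrt b) u))"
  then show "ennreal (2 * sqrt pi) *
          (\<integral>\<^sup>+ u\<in>{sqrt (1 - a)..}.
             ennreal (exp (- 2 * sqrt b * u) / (c * u\<^sup>2 + a * c - 1)) \<partial>lborel) =
          ennreal (sqrt (pi / b)) *
          (\<integral>\<^sup>+ \<omega>. ennreal (inverse (c * (\<xi> \<omega>)\<^sup>2 + a * c - 1)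
             * indicator {\<omega>. \<xi> \<omega> \<ge> sqrt (1 - a)} \<omega>) \<partial>M)"
    using a b by (intro exponential_expectation_eq_nn_integral[symmetric]) auto
next
  fix a b c :: real
  assume "b \<in> {0<..}" "a \<in> {0<..<1}" "c \<in> {1 / a..}"
  then have a: "0 < a" "a \<le> 1" "1 < 1 / a" and b: "0 < b" and c: "1 / a \<le> c" by auto
  show "terms_well_defined a b"
    using series_integrand_integrable(1)[OF a(1,2) b] by (simp add: terms_well_defined_def)
  show "summable (\<lambda>n. series_term a b c (Suc n))"
    by (rule series_summable_and_suminf(1)[OF a(1,2) b c less_le_trans[OF a(3) c]])
next
  fix b c :: real
  assume "b \<in> {0<..}" "c \<in> {1<..}"
  then show "summable (\<lambda>n. series_term 1 b c (Suc n))"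
    by (intro series_summable_and_suminf(1)) auto
next
  fix b c :: real
  assume "b \<in> {0<..}" "c \<in> {1<..}"
  then have b: "0 < b" and c: "1 < c" by auto
  show "set_integrable lborel {0<..} (\<lambda>u. exp (- 2 * sqrt b * u) / (c * u\<^sup>2 + c - 1))"
    by (rule series_sums_integral(1)[OF b c])
  show "(\<lambda>n. series_term 1 b c (Suc n)) sums
          (2 * sqrt pi * (LBINT u:{0<..}. exp (- 2 * sqrt b * u) / (c * u\<^sup>2 + c - 1)))"
    by (rule series_sums_integral(2)[OF b c])
  show "2 * sqrt pi * (LBINT u:{0<..}. exp (- 2 * sqrt b * u) / (c * u\<^sup>2 + c - 1)) =
          sqrt (pi / (c * (c - 1))) *
          (2 * sin (ell b c) * Ci (ell b c) + cos (ell b c) * (pi - 2 * Si (ell b c)))"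
    by (rule laplace_inverse_quadratic[OF b c])
qed (auto simp: terms_well_defined_def series_not_summable series_integrand_integrable(1))

end
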